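(* Let $f:P\to Q$ be a surjective $\mathbf{P}$-morphism between finite posets and let $n=\#P-\#Q$. Then there exist finite posets $Q_0,\dots,Q_n$ with $Q_0=P$ and $Q_n=Q$, and minimal surjective $\mathbf{P}$-morphisms $f_i:Q_{i-1}\to Q_i$ for $i=1,\dots,n$, such that $f=f_n\circ\cdots\circ f_1$ (composition of partial maps).
   Context: For finite posets $P,Q$, a $\mathbf{P}$-morphism $\alpha:P\to Q$ is a partial map with domain $\mathrm{dom}\,\alpha\subseteq P$ such that (i) for $p,q\in\mathrm{dom}\,\alpha$, $p<q$ implies $\alpha(p)<\alpha(q)$, and (ii) for $p\in\mathrm{dom}\,\alpha$ and $q\in Q$ with $\alpha(p)<q$ there is $r\in\mathrm{dom}\,\alpha$ with $p<r$ and $\alpha(r)=q$. It is surjective if its image is all of $Q$. A surjective $\mathbf{P}$-morphism $f:P\to Q$ is minimal if $\#P=\#Q+1$.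
   Formalization: For n = 0 the claim would force P = Q and f = identity, which fails e.g. for the swap of a two-element antichain; in that case the formal theorem states instead that f is an isomorphism of posets. For n > 0 the statement is as given. *)

theory Defs
  imports Main
begin

(* A poset is a reflexive partial order relation r; its underlying set is Field r
   (by reflexivity no element is lost), and its strict order is r - Id. *)
definition finite_poset :: "'a rel \<Rightarrow> bool" where
  "finite_poset P \<longleftrightarrow> Partial_order P \<and> finite (Field P)"

definition P_morphism :: "'a rel \<Rightarrow> 'b rel \<Rightarrow> ('a \<rightharpoonup> 'b) \<Rightarrow> bool" where
  "P_morphism P Q \<alpha> \<longleftrightarrow>
     dom \<alpha> \<subseteq> Field P \<and> ran \<alpha> \<subseteq> Field Q \<and>
     (\<forall>p\<in>dom \<alpha>. \<forall>q\<in>dom \<alpha>. (p, q) \<in> P - Id \<longrightarrow> (the (\<alpha> p), the (\<alpha> q)) \<in> Q - Id) \<and>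
     (\<forall>p\<in>dom \<alpha>. \<forall>q\<in>Field Q. (the (\<alpha> p), q) \<in> Q - Id \<longrightarrow>
        (\<exists>r\<in>dom \<alpha>. (p, r) \<in> P - Id \<and> \<alpha> r = Some q))"

definition surjective_P_morphism :: "'a rel \<Rightarrow> 'b rel \<Rightarrow> ('a \<rightharpoonup> 'b) \<Rightarrow> bool" where
  "surjective_P_morphism P Q f \<longleftrightarrow> P_morphism P Q f \<and> ran f = Field Q"

definition minimal_surjective_P_morphism :: "'a rel \<Rightarrow> 'b rel \<Rightarrow> ('a \<rightharpoonup> 'b) \<Rightarrow> bool" where
  "minimal_surjective_P_morphism P Q f \<longleftrightarrow>
     surjective_P_morphism P Q f \<and> card (Field P) = card (Field Q) + 1"

(* When #P = #Q there are no factors: the empty composite is an identity map, so a surjective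
   P-morphism P -> Q can equal it only up to isomorphism of posets. *)
definition poset_isomorphism :: "'a rel \<Rightarrow> 'b rel \<Rightarrow> ('a \<rightharpoonup> 'b) \<Rightarrow> bool" where
  "poset_isomorphism P Q f \<longleftrightarrow>
     dom f = Field P \<and> bij_betw (\<lambda>p. the (f p)) (Field P) (Field Q) \<and>
     (\<forall>p\<in>Field P. \<forall>q\<in>Field P. (p, q) \<in> P \<longleftrightarrow> (the (f p), the (f q)) \<in> Q)"

(* composite g n = g n o ... o g 1; the entry g 0 is not used.  The recursion starts at the
   identity of the whole type, which is neutral for the composition of partial maps. *)
primrec composite :: "(nat \<Rightarrow> 'a \<rightharpoonup> 'a) \<Rightarrow> nat \<Rightarrow> 'a \<rightharpoonup> 'a" where
  "composite g 0 = Some"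
| "composite g (Suc k) = g (Suc k) \<circ>\<^sub>m composite g k"

end

theory Submission
  imports Defs
begin

text \<open>
  If \<open>#P > #Q\<close>, then \<open>f\<close> factors through a poset with one point less than \<open>P\<close>, and one
  iterates. If some point is outside the domain of \<open>f\<close>, delete it. Otherwise \<open>f\<close> is total and
  not injective; choose \<open>q\<close> maximal among the points of \<open>Q\<close> with at least two preimages, and let
  \<open>x\<close>, \<open>y\<close> be two of them. Above \<open>q\<close> the map \<open>f\<close> is injective, so exactly the preimages of the
  points above \<open>q\<close> lie above \<open>x\<close>, and likewise above \<open>y\<close>. Hence \<open>x\<close> and \<open>y\<close> are incomparable
  with the same strict upper bounds, and they can be identified.
\<close>

section \<open>Elementwise forms of the definitions\<close>

lemma finite_poset_iff:
  "finite_poset P \<longleftrightarrow>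
     (\<forall>x\<in>Field P. (x, x) \<in> P) \<and> trans P \<and> antisym P \<and> finite (Field P)"
  by (auto simp: finite_poset_def partial_order_on_def preorder_on_def refl_on_def
      intro: FieldI1 FieldI2)

text \<open>Equations \<open>\<alpha> p = Some q\<close> in place of \<open>the\<close> and of
  quantifiers over \<open>dom \<alpha>\<close> give both conditions a form that serves directly as
  introduction and destruction rules.\<close>

lemma P_morphism_iff:
  "P_morphism P Q \<alpha> \<longleftrightarrow>
     dom \<alpha> \<subseteq> Field P \<and> ran \<alpha> \<subseteq> Field Q \<and>
     (\<forall>p p' q q'. \<alpha> p = Some q \<longrightarrow> \<alpha> p' = Some q' \<longrightarrow> (p, p') \<in> P - Id \<longrightarrow> (q, q') \<in> Q - Id) \<and>
     (\<forall>p q q'. \<alpha> p = Some q \<longrightarrow> (q, q') \<in> Q - Id \<longrightarrow>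
        (\<exists>r. (p, r) \<in> P - Id \<and> \<alpha> r = Some q'))"
proof -
  have dom: "(\<forall>p\<in>dom \<alpha>. R p (the (\<alpha> p))) \<longleftrightarrow> (\<forall>p q. \<alpha> p = Some q \<longrightarrow> R p q)" for R
    by (metis domD domI option.sel)
  have 1: "(\<forall>p\<in>dom \<alpha>. \<forall>p'\<in>dom \<alpha>. (p, p') \<in> P - Id \<longrightarrow> (the (\<alpha> p), the (\<alpha> p')) \<in> Q - Id) \<longleftrightarrow>
      (\<forall>p q. \<alpha> p = Some q \<longrightarrow> (\<forall>p' q'. \<alpha> p' = Some q' \<longrightarrow> (p, p') \<in> P - Id \<longrightarrow> (q, q') \<in> Q - Id))"
    unfolding dom[where R = "\<lambda>p' q'. (p, p') \<in> P - Id \<longrightarrow> (q, q') \<in> Q - Id" for p q]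
    by (rule dom)
  have range: "(\<forall>q'\<in>Field Q. (q, q') \<in> Q - Id \<longrightarrow> R q') \<longleftrightarrow> (\<forall>q'. (q, q') \<in> Q - Id \<longrightarrow> R q')" for R q
    by (auto intro: FieldI2)
  have bex: "(\<exists>r\<in>dom \<alpha>. (p, r) \<in> P - Id \<and> \<alpha> r = Some q) \<longleftrightarrow> (\<exists>r. (p, r) \<in> P - Id \<and> \<alpha> r = Some q)" for p q
    by auto
  have 2: "(\<forall>p\<in>dom \<alpha>. \<forall>q\<in>Field Q. (the (\<alpha> p), q) \<in> Q - Id \<longrightarrow>
        (\<exists>r\<in>dom \<alpha>. (p, r) \<in> P - Id \<and> \<alpha> r = Some q)) \<longleftrightarrow>
      (\<forall>p q. \<alpha> p = Some q \<longrightarrow> (\<forall>q'. (q, q') \<in> Q - Id \<longrightarrow> (\<exists>r. (p, r) \<in> P - Id \<and> \<alpha> r = Some q')))"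
    unfolding bex range by (rule dom)
  show ?thesis
    unfolding P_morphism_def 1 2 by meson
qed

lemma surjective_P_morphismI:
  assumes "dom \<alpha> \<subseteq> Field P" and "ran \<alpha> = Field Q"
    and "\<And>p p' q q'. \<lbrakk>\<alpha> p = Some q; \<alpha> p' = Some q'; (p, p') \<in> P; p \<noteq> p'\<rbrakk>
           \<Longrightarrow> (q, q') \<in> Q \<and> q \<noteq> q'"
    and "\<And>p q q'. \<lbrakk>\<alpha> p = Some q; (q, q') \<in> Q; q \<noteq> q'\<rbrakk>
           \<Longrightarrow> \<exists>r. (p, r) \<in> P \<and> p \<noteq> r \<and> \<alpha> r = Some q'"
  shows "surjective_P_morphism P Q \<alpha>"
  unfolding surjective_P_morphism_def P_morphism_iff
proof (intro conjI allI impI)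
  show "(q, q') \<in> Q - Id" if "\<alpha> p = Some q" "\<alpha> p' = Some q'" "(p, p') \<in> P - Id" for p p' q q'
    using assms(3)[OF that(1,2)] that(3) by simp
  show "\<exists>r. (p, r) \<in> P - Id \<and> \<alpha> r = Some q'" if "\<alpha> p = Some q" "(q, q') \<in> Q - Id" for p q q'
    using assms(4)[OF that(1), of q'] that(2) by auto
qed (simp_all add: assms(1,2))

lemma surjective_P_morphismD:
  assumes "surjective_P_morphism P Q \<alpha>"
  shows "dom \<alpha> \<subseteq> Field P" and "ran \<alpha> = Field Q"
    and "\<lbrakk>\<alpha> p = Some q; \<alpha> p' = Some q'; (p, p') \<in> P; p \<noteq> p'\<rbrakk> \<Longrightarrow> (q, q') \<in> Q \<and> q \<noteq> q'"
    and "\<lbrakk>\<alpha> p = Some q; (q, q') \<in> Q; q \<noteq> q'\<rbrakk> \<Longrightarrow> \<exists>r. (p, r) \<in> P \<and> p \<noteq> r \<and> \<alpha> r = Some q'"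
  using assms unfolding surjective_P_morphism_def P_morphism_iff by blast+

section \<open>Cardinalities, and the case without factors\<close>

lemma ran_eq_image_dom: "ran f = (\<lambda>p. the (f p)) ` dom f"
  by (force simp: ran_def dom_def)

text \<open>Makes the truncated subtraction that defines \<open>n\<close> in the theorem a true
  difference.\<close>

lemma surjective_P_morphism_card:
  assumes "finite_poset P" and "surjective_P_morphism P Q f"
  shows "card (Field Q) \<le> card (Field P)"
proof -
  have fin: "finite (Field P)"
    using assms(1) by (simp add: finite_poset_iff)
  have "card (ran f) \<le> card (dom f)"
    unfolding ran_eq_image_dom
    by (rule card_image_le) (rule finite_subset[OF surjective_P_morphismD(1)[OF assms(2)] fin])
  also have "\<dots> \<le> card (Field P)"
    by (rule card_mono[OF fin surjective_P_morphismD(1)[OF assms(2)]])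
  finally show ?thesis
    using surjective_P_morphismD(2)[OF assms(2)] by simp
qed

text \<open>A surjection from a subset of \<open>Field P\<close> onto a set at least as large as
  \<open>Field P\<close> must be defined everywhere and injective. Conditions (i) and (ii) then
  preserve and reflect the order.\<close>

lemma poset_isomorphism_if_card_le:
  assumes P: "finite_poset P" and Q: "finite_poset Q" and f: "surjective_P_morphism P Q f"
    and card: "card (Field P) \<le> card (Field Q)"
  shows "poset_isomorphism P Q f"
proof -
  note f = surjective_P_morphismD[OF f]
  have fin: "finite (Field P)" "finite (dom f)"
    using P f(1) by (auto simp: finite_poset_iff intro: finite_subset)
  have img: "Field Q = (\<lambda>p. the (f p)) ` dom f"
    using f(2) by (simp add: ran_eq_image_dom)
  then have "card (Field Q) \<le> card (dom f)"
    using card_image_le fin(2) by metis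
  then have dom: "dom f = Field P"
    using card card_seteq[OF fin(1) f(1)] by linarith
  have total: "f p = Some (the (f p))" if "p \<in> Field P" for p
    using that dom by force
  have inj: "inj_on (\<lambda>p. the (f p)) (Field P)"
  proof (rule eq_card_imp_inj_on[OF fin(1)])
    show "card ((\<lambda>p. the (f p)) ` Field P) = card (Field P)"
      using img dom card card_image_le[OF fin(1)] by (metis le_antisym)
  qed
  \<comment> \<open>Condition (ii) lifts the relation between the images to some \<open>r\<close>
    above \<open>p\<close> with the same value as \<open>p'\<close>; injectivity gives
    \<open>r = p'\<close>.\<close>
  have reflect: "(p, p') \<in> P" 
    if pp': "p \<in> Field P" "p' \<in> Field P" "(the (f p), the (f p')) \<in> Q" for p p'
  proof (cases "p = p'")
    case True
    then show ?thesis
      using P pp' by (simp add: finite_poset_iff)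
  next
    case False
    then have "the (f p) \<noteq> the (f p')"
      using inj pp' by (auto dest: inj_onD)
    moreover have "f p = Some (the (f p))"
      using pp'(1) by (rule total)
    ultimately obtain r where r: "(p, r) \<in> P" "f r = Some (the (f p'))"
      using f(4)[OF _ pp'(3)] by blast
    moreover have "r = p'"
      using r inj_onD[OF inj _ FieldI2[OF r(1)] pp'(2)] by simp
    ultimately show ?thesis by simp
  qed
  have preserve: "(the (f p), the (f p')) \<in> Q"
    if "p \<in> Field P" "p' \<in> Field P" "(p, p') \<in> P" for p p'
  proof (cases "p = p'")
    case True
    then show ?thesis
      using Q that img dom by (auto simp: finite_poset_iff)
  next
    case False
    then show ?thesis
      using f(3)[of p _ p'] total that by (metis option.sel)
  qed
  show ?thesis
    unfolding poset_isomorphism_def bij_betw_def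
    using inj img dom by (auto intro: reflect preserve)
qed

section \<open>Splitting off one minimal morphism\<close>

lemma factor_delete_point:
  fixes P :: "'a rel"
  assumes P: "finite_poset P" and f: "surjective_P_morphism P Q f"
    and p0: "p0 \<in> Field P" "f p0 = None"
  shows "\<exists>(P' :: 'a rel) g f'. finite_poset P' \<and> minimal_surjective_P_morphism P P' g \<and>
           surjective_P_morphism P' Q f' \<and> f = f' \<circ>\<^sub>m g"
proof -
  note f = surjective_P_morphismD[OF f]
  let ?D = "Field P - {p0}"
  \<comment> \<open>The first factor is the partial identity onto the induced subposet; the second
    is \<open>f\<close> itself, whose domain avoids \<open>p0\<close>.\<close>
  define P' where "P' = P \<inter> ?D \<times> ?D"
  define g where "g = Some |` ?D"
  have refl: "\<And>x. x \<in> Field P \<Longrightarrow> (x, x) \<in> P" and fin: "finite (Field P)"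
    and "trans P" "antisym P"
    using P by (auto simp: finite_poset_iff)
  have F: "Field P' = ?D"
  proof
    show "Field P' \<subseteq> ?D" by (auto simp: P'_def Field_def)
    show "?D \<subseteq> Field P'" using refl by (auto simp: P'_def intro!: FieldI1)
  qed
  have "trans P'"
    using \<open>trans P\<close> unfolding P'_def trans_def by blast
  then have P': "finite_poset P'"
    unfolding finite_poset_iff F using refl fin \<open>antisym P\<close> by (auto simp: P'_def antisym_def)
  have D: "p \<in> ?D" if "f p = Some q" for p q
    using f(1) domI[of f, OF that] that p0(2) by auto
  have g_Some: "g p = Some q \<longleftrightarrow> p = q \<and> p \<in> ?D" for p q
    by (auto simp: g_def restrict_map_def)
  have "surjective_P_morphism P P' g"
  proof (rule surjective_P_morphismI)
    show "dom g \<subseteq> Field P" by (auto simp: g_def)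
    show "ran g = Field P'" unfolding F ran_def g_Some by blast
  qed (auto simp: g_Some P'_def)
  moreover have "card (Field P) = card (Field P') + 1"
    using card.remove[OF fin p0(1)] by (simp add: F)
  moreover have "surjective_P_morphism P' Q f"
  proof (rule surjective_P_morphismI)
    show "dom f \<subseteq> Field P'" unfolding F dom_def using D by blast
    show "ran f = Field Q" by (rule f(2))
    show "(q, q') \<in> Q \<and> q \<noteq> q'"
      if "f p = Some q" "f p' = Some q'" "(p, p') \<in> P'" "p \<noteq> p'" for p p' q q'
      using f(3)[OF that(1,2) _ that(4)] that(3) by (simp add: P'_def)
    show "\<exists>r. (p, r) \<in> P' \<and> p \<noteq> r \<and> f r = Some q'"
      if "f p = Some q" "(q, q') \<in> Q" "q \<noteq> q'" for p q q'
      using f(4)[OF that] D[OF that(1)] D unfolding P'_def by blast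
  qed
  moreover have "f = f \<circ>\<^sub>m g"
  proof
    fix p
    show "f p = (f \<circ>\<^sub>m g) p"
      using D by (cases "f p") (auto simp: g_def map_comp_def restrict_map_def)
  qed
  ultimately show ?thesis
    using P' unfolding minimal_surjective_P_morphism_def by blast
qed

text \<open>Points of one fibre are incomparable, so \<open>up\<close> says that \<open>x\<close>
  and \<open>y\<close> have the same strict upper bounds. This makes the quotient antisymmetric and
  transitive, and lets its relations lift to \<open>P\<close>.\<close>

lemma factor_identify_points:
  fixes P :: "'a rel"
  assumes P: "finite_poset P" and f: "surjective_P_morphism P Q f"
    and fx: "f x = Some q" and fy: "f y = Some q" and "x \<noteq> y"
    and up: "\<And>z. z \<noteq> x \<Longrightarrow> z \<noteq> y \<Longrightarrow> (x, z) \<in> P \<longleftrightarrow> (y, z) \<in> P"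
  shows "\<exists>(P' :: 'a rel) g f'. finite_poset P' \<and> minimal_surjective_P_morphism P P' g \<and>
           surjective_P_morphism P' Q f' \<and> f = f' \<circ>\<^sub>m g"
proof -
  note f = surjective_P_morphismD[OF f]
  let ?D = "Field P - {y}"
  \<comment> \<open>\<open>x\<close> represents the class of \<open>x\<close> and \<open>y\<close>,
    so it also receives the points below \<open>y\<close>. Upward nothing is added, because of
    \<open>up\<close>.\<close>
  define P' where "P' = {(a, b) \<in> ?D \<times> ?D. (a, b) \<in> P \<or> b = x \<and> (a, y) \<in> P}"
  define g where "g = (\<lambda>p. if p \<in> Field P then Some (if p = y then x else p) else None)"
  define f' where "f' = f |` ?D"
  have refl: "\<And>z. z \<in> Field P \<Longrightarrow> (z, z) \<in> P" and fin: "finite (Field P)"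
    and trans: "\<And>a b c. (a, b) \<in> P \<Longrightarrow> (b, c) \<in> P \<Longrightarrow> (a, c) \<in> P"
    and antisym: "\<And>a b. (a, b) \<in> P \<Longrightarrow> (b, a) \<in> P \<Longrightarrow> a = b"
    using P by (auto simp: finite_poset_iff dest: transD antisymD)
  have incomparable: "(x, y) \<notin> P" "(y, x) \<notin> P"
    using f(3) fx fy \<open>x \<noteq> y\<close> by blast+
  have D: "x \<in> ?D" "y \<in> Field P"
    using f(1) fx fy \<open>x \<noteq> y\<close> by auto
  have F: "Field P' = ?D"
  proof
    show "Field P' \<subseteq> ?D" by (auto simp: P'_def Field_def)
    show "?D \<subseteq> Field P'" using refl by (auto simp: P'_def intro!: FieldI1)
  qed
  have P'_x: "(a, b) \<in> P'" if "(a, y) \<in> P" "b = x" "a \<noteq> y" for a b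
    using that D FieldI1[OF that(1)] by (simp add: P'_def)
  have P'_P: "(a, b) \<in> P'" if "(a, b) \<in> P" "a \<noteq> y" "b \<noteq> y" for a b
    using that FieldI1[OF that(1)] FieldI2[OF that(1)] by (simp add: P'_def)
  have P'_cases: "a \<noteq> y \<and> b \<noteq> y \<and> ((a, b) \<in> P \<or> b = x \<and> (a, y) \<in> P)" if "(a, b) \<in> P'" for a b
    using that by (auto simp: P'_def)
  have "trans P'"
  proof (rule transI)
    fix a b c assume ab: "(a, b) \<in> P'" and bc: "(b, c) \<in> P'"
    \<comment> \<open>In the critical case \<open>b = x\<close> with \<open>a\<close> below
      \<open>y\<close> and \<open>c\<close> strictly above \<open>x\<close>, \<open>up\<close> puts
      \<open>c\<close> above \<open>y\<close>, hence above \<open>a\<close>.\<close>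
    show "(a, c) \<in> P'"
      using P'_cases[OF ab] P'_cases[OF bc] trans up incomparable P'_x P'_P by metis
  qed
  moreover have "antisym P'"
  proof (rule antisymI)
    fix a b assume ab: "(a, b) \<in> P'" and ba: "(b, a) \<in> P'"
    show "a = b"
      using P'_cases[OF ab] P'_cases[OF ba] antisym up incomparable by metis
  qed
  ultimately have P': "finite_poset P'"
    unfolding finite_poset_iff F using fin refl P'_P by auto
  have g_Some: "g p = Some q \<longleftrightarrow> p \<in> Field P \<and> q = (if p = y then x else p)" for p q
    by (auto simp: g_def)
  have f'_Some: "f' p = Some r \<longleftrightarrow> p \<noteq> y \<and> f p = Some r" for p r
    using f(1) by (auto simp: f'_def restrict_map_def)
  have "surjective_P_morphism P P' g"
  proof (rule surjective_P_morphismI)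
    show "dom g \<subseteq> Field P" by (auto simp: g_def split: if_splits)
    show "ran g = Field P'" unfolding F ran_def g_Some using D(1) by auto
    show "(q, q') \<in> P' \<and> q \<noteq> q'"
      if "g p = Some q" "g p' = Some q'" "(p, p') \<in> P" "p \<noteq> p'" for p p' q q'
      using that up incomparable P'_x P'_P \<open>x \<noteq> y\<close> unfolding g_Some by metis
    \<comment> \<open>Take \<open>r = q'\<close>, with \<open>up\<close> supplying the relation when
      \<open>p = y\<close>. If the pair stems from \<open>(p, y) \<in> P\<close> with
      \<open>q' = x\<close>, take \<open>r = y\<close>.\<close>
    show "\<exists>r. (p, r) \<in> P \<and> p \<noteq> r \<and> g r = Some q'"
      if "g p = Some q" "(q, q') \<in> P'" "q \<noteq> q'" for p q q'
    proof -
      have "q' \<in> Field P"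
        using that(2) by (auto simp: P'_def)
      then show ?thesis
        using that P'_cases[OF that(2)] up incomparable D(2) unfolding g_Some by metis
    qed
  qed
  moreover have "card (Field P) = card (Field P') + 1"
    using card.remove[OF fin D(2)] by (simp add: F)
  moreover have "surjective_P_morphism P' Q f'"
  proof (rule surjective_P_morphismI)
    show "dom f' \<subseteq> Field P'" by (auto simp: f'_def F)
    \<comment> \<open>Dropping \<open>y\<close> loses no value, since \<open>x\<close> has the same
      one.\<close>
    have "\<exists>p. p \<noteq> y \<and> f p = Some r" if "f p = Some r" for p r
      using that fx fy \<open>x \<noteq> y\<close> by (cases "p = y") auto
    then show "ran f' = Field Q"
      unfolding f(2)[symmetric] ran_def f'_Some by blast
    show "(r, r') \<in> Q \<and> r \<noteq> r'"
      if "f' p = Some r" "f' p' = Some r'" "(p, p') \<in> P'" "p \<noteq> p'" for p p' r r'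
      using that(1,2,4) P'_cases[OF that(3)] f(3) fx fy unfolding f'_Some by (metis option.inject)
    show "\<exists>s. (p, s) \<in> P' \<and> p \<noteq> s \<and> f' s = Some r'"
      if p: "f' p = Some r" and r: "(r, r') \<in> Q" "r \<noteq> r'" for p r r'
    proof -
      have p': "p \<noteq> y" "f p = Some r" using p f'_Some by auto
      then obtain s where s: "(p, s) \<in> P" "p \<noteq> s" "f s = Some r'"
        using f(4) r by blast
      show ?thesis
      \<comment> \<open>A lift ending at \<open>y\<close> is redirected to \<open>x\<close>, which
        has the same value and lies above \<open>p\<close> in \<open>P'\<close>. Here
        \<open>p \<noteq> x\<close>, as the values \<open>r\<close> and \<open>r'\<close>
        differ.\<close>
      proof (cases "s = y")
        case True
        moreover from this have "p \<noteq> x" using s p' fx fy r(2) by auto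
        ultimately show ?thesis
          using s p' fx fy P'_x \<open>x \<noteq> y\<close> f'_Some by (metis option.inject)
      next
        case False
        then show ?thesis
          using s p' P'_P f'_Some by blast
      qed
    qed
  qed
  moreover have "f = f' \<circ>\<^sub>m g"
  proof
    fix p
    show "f p = (f' \<circ>\<^sub>m g) p"
      using f(1) fx fy D by (auto simp: f'_def g_def map_comp_def restrict_map_def)
  qed
  ultimately show ?thesis
    using P' unfolding minimal_surjective_P_morphism_def by blast
qed

lemma finite_poset_has_maximal:
  assumes Q: "finite_poset Q" and "A \<subseteq> Field Q" and "A \<noteq> {}"
  obtains m where "m \<in> A" and "\<And>a. \<lbrakk>a \<in> A; (m, a) \<in> Q\<rbrakk> \<Longrightarrow> a = m"
proof -
  let ?less = "\<lambda>a b. (a, b) \<in> Q \<and> a \<noteq> b"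
  have trans: "trans Q" and antisym: "antisym Q" and fin: "finite A"
    using Q finite_subset[OF \<open>A \<subseteq> Field Q\<close>] by (auto simp: finite_poset_iff)
  have "\<exists>m\<in>A. \<forall>a\<in>A. a \<noteq> m \<longrightarrow> \<not> ?less m a"
  proof (rule Finite_Set.bex_max_element[OF fin _ _ \<open>A \<noteq> {}\<close>])
    show "asymp_on A ?less"
      using antisym by (auto intro!: asymp_onI dest: antisymD)
    show "transp_on A ?less"
      using trans antisym by (auto intro!: transp_onI dest: transD antisymD)
  qed
  then show thesis
    using that by blast
qed

lemma minimal_factor:
  fixes P :: "'a rel"
  assumes P: "finite_poset P" and Q: "finite_poset Q" and f: "surjective_P_morphism P Q f"
    and card: "card (Field Q) < card (Field P)"
  shows "\<exists>(P' :: 'a rel) g f'. finite_poset P' \<and> minimal_surjective_P_morphism P P' g \<and>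
           surjective_P_morphism P' Q f' \<and> f = f' \<circ>\<^sub>m g"
proof (cases "dom f = Field P")
  case False
  then obtain p0 where "p0 \<in> Field P" "f p0 = None"
    using surjective_P_morphismD(1)[OF f] by blast
  then show ?thesis
    by (rule factor_delete_point[OF P f])
next
  case total: True
  note fD = surjective_P_morphismD[OF f]
  define A where "A = {q. \<exists>x y. x \<noteq> y \<and> f x = Some q \<and> f y = Some q}"
  have "Field Q = (\<lambda>p. the (f p)) ` Field P"
    using fD(2) total by (simp add: ran_eq_image_dom)
  \<comment> \<open>An injective total surjection would make the cardinalities equal. So
    \<open>A\<close>, the set of values with several preimages, is nonempty.\<close>
  then have "\<not> inj_on (\<lambda>p. the (f p)) (Field P)"
    using card card_image by fastforce
  then obtain x y where "x \<in> dom f" "y \<in> dom f" "x \<noteq> y" "the (f x) = the (f y)"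
    using total unfolding inj_on_def by blast
  then have "the (f x) \<in> A"
    unfolding A_def by force
  moreover have "A \<subseteq> Field Q"
    using fD(2) by (auto simp: A_def ran_def)
  ultimately obtain q where "q \<in> A" and max: "\<And>a. a \<in> A \<Longrightarrow> (q, a) \<in> Q \<Longrightarrow> a = q"
    using finite_poset_has_maximal[OF Q] by blast
  then obtain x y where xy: "x \<noteq> y" "f x = Some q" "f y = Some q"
    unfolding A_def by blast
  \<comment> \<open>Condition (ii) at \<open>v\<close> yields \<open>r\<close> above
    \<open>v\<close> with the value of \<open>z\<close>. That value is above \<open>q\<close>, so by
    maximality its only preimage is \<open>z\<close>. Having \<open>u\<close> and \<open>v\<close>
    arbitrary in the fibre gives both directions for \<open>x\<close> and \<open>y\<close>.\<close>
  have up: "(v, z) \<in> P" if prems: "f u = Some q" "f v = Some q" "(u, z) \<in> P" "z \<noteq> u" for u v z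
  proof -
    obtain c where c: "f z = Some c"
      using total prems(3) by (metis FieldI2 domD)
    then have less: "(q, c) \<in> Q" "q \<noteq> c"
      using fD(3) prems by blast+
    then obtain r where r: "(v, r) \<in> P" "f r = Some c"
      using fD(4) prems(2) by blast
    have "c \<notin> A" using max less by blast
    then have "r = z" using r c unfolding A_def by blast
    with r show ?thesis by simp
  qed
  show ?thesis
    using up xy by (intro factor_identify_points[OF P f xy(2,3,1)]) blast
qed

section \<open>Chains of minimal morphisms\<close>

text \<open>The recursion of \<open>composite\<close> peels off the last factor, whereas the
  induction below splits off the first; associativity mediates.\<close>

lemma composite_Suc_shift:
  "composite g (Suc k) = composite (\<lambda>i. g (Suc i)) k \<circ>\<^sub>m g 1"
proof (induction k)
  case 0
  show ?case by (auto simp: map_comp_def fun_eq_iff split: option.splits)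
next
  case (Suc k)
  have "composite g (Suc (Suc k)) = g (Suc (Suc k)) \<circ>\<^sub>m composite g (Suc k)"
    by simp
  also have "\<dots> = composite (\<lambda>i. g (Suc i)) (Suc k) \<circ>\<^sub>m g 1"
    unfolding Suc by (auto simp: map_comp_def fun_eq_iff split: option.splits)
  finally show ?case .
qed

text \<open>Induction on the cardinality difference with \<open>Q\<close> fixed, since each split
  replaces only the source and the map. It starts at difference one, where \<open>f\<close> is its
  own factorization: the empty composite is the identity of the whole type.\<close>

lemma minimal_factorization:
  fixes P Q :: "'a rel"
  assumes "finite_poset P" and "finite_poset Q" and "surjective_P_morphism P Q f"
    and "card (Field P) = card (Field Q) + Suc m"
  shows "\<exists>(Qs :: nat \<Rightarrow> 'a rel) fs. Qs 0 = P \<and> Qs (Suc m) = Q \<and>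
           (\<forall>i\<le>Suc m. finite_poset (Qs i)) \<and>
           (\<forall>i\<le>m. minimal_surjective_P_morphism (Qs i) (Qs (Suc i)) (fs (Suc i))) \<and>
           f = composite fs (Suc m)"
  using assms
proof (induction m arbitrary: P f)
  case 0
  define Qs where "Qs = case_nat P (\<lambda>_. Q)"
  have "f = composite (\<lambda>_. f) 1"
    by (simp add: map_comp_def)
  moreover have "minimal_surjective_P_morphism P Q f"
    using 0 by (simp add: minimal_surjective_P_morphism_def)
  ultimately show ?case
    using 0 by (intro exI[of _ Qs] exI[of _ "\<lambda>_. f"]) (auto simp: Qs_def split: nat.split)
next
  case (Suc m)
  have "card (Field Q) < card (Field P)"
    using Suc.prems(4) by simp
  then obtain P' :: "'a rel" and g f' where P': "finite_poset P'" and g: "minimal_surjective_P_morphism P P' g"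
    and f': "surjective_P_morphism P' Q f'" and fg: "f = f' \<circ>\<^sub>m g"
    using minimal_factor[OF Suc.prems(1-3)] by blast
  have "card (Field P') = card (Field Q) + Suc m"
    using g Suc.prems(4) by (simp add: minimal_surjective_P_morphism_def)
  with Suc.IH[OF P' Suc.prems(2) f'] obtain Qs fs where
    Qs: "Qs 0 = P'" "Qs (Suc m) = Q" "\<forall>i\<le>Suc m. finite_poset (Qs i)"
      "\<forall>i\<le>m. minimal_surjective_P_morphism (Qs i) (Qs (Suc i)) (fs (Suc i))"
    and f'_comp: "f' = composite fs (Suc m)"
    by blast
  \<comment> \<open>\<open>P\<close> is put in front of the chain from \<open>P'\<close> to
    \<open>Q\<close>. Posets are indexed from 0 and morphisms from 1, so \<open>g\<close> takes
    index 1.\<close>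
  define Rs where "Rs = case_nat P Qs"
  define gs where "gs = (\<lambda>i. if i = 1 then g else fs (i - 1))"
  \<comment> \<open>The two sequences agree from index 1 on, which is where \<open>composite\<close>
    starts reading; at index 0 the shifted one has \<open>g\<close>.\<close>
  have composite_cong: "composite (\<lambda>i. gs (Suc i)) k = composite fs k" for k
    by (induction k) (simp_all add: gs_def)
  have "f = composite gs (Suc (Suc m))"
    unfolding composite_Suc_shift[of gs] composite_cong
    using fg f'_comp by (simp add: gs_def)
  moreover have "\<forall>i\<le>Suc (Suc m). finite_poset (Rs i)"
    using Suc.prems(1) Qs(3) by (auto simp: Rs_def split: nat.split)
  moreover have "minimal_surjective_P_morphism (Rs i) (Rs (Suc i)) (gs (Suc i))" if "i \<le> Suc m" for i
    using that g Qs(1,4) by (cases i) (auto simp: Rs_def gs_def)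
  ultimately show ?case
    using Qs(2) by (intro exI[of _ Rs] exI[of _ gs]) (auto simp: Rs_def)
qed

theorem theorem3p5:
  fixes P Q :: "'a rel" and f :: "'a \<rightharpoonup> 'a" and n :: nat
  assumes "finite_poset P" and "finite_poset Q"
    and "surjective_P_morphism P Q f"
    and "n = card (Field P) - card (Field Q)"
  shows "(n > 0 \<longrightarrow>
           (\<exists>(Qs :: nat \<Rightarrow> 'a rel) (fs :: nat \<Rightarrow> 'a \<rightharpoonup> 'a).
              Qs 0 = P \<and> Qs n = Q \<and>
              (\<forall>i\<le>n. finite_poset (Qs i)) \<and>
              (\<forall>i\<in>{1..n}. minimal_surjective_P_morphism (Qs (i - 1)) (Qs i) (fs i)) \<and>
              f = composite fs n)) \<and>
         (n = 0 \<longrightarrow> poset_isomorphism P Q f)"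
proof (intro conjI impI)
  assume "n = 0"
  \<comment> \<open>A truncated difference of 0 means
    \<open>card (Field P) \<le> card (Field Q)\<close>.\<close>
  then show "poset_isomorphism P Q f"
    using poset_isomorphism_if_card_le assms by auto
next
  assume "n > 0"
  then obtain m where n: "n = Suc m"
    using gr0_implies_Suc by blast
  have "card (Field P) = card (Field Q) + Suc m"
    using assms(4) n surjective_P_morphism_card[OF assms(1,3)] by linarith
  from minimal_factorization[OF assms(1-3) this] obtain Qs :: "nat \<Rightarrow> 'a rel" and fs where
    Qs: "Qs 0 = P" "Qs n = Q" "\<forall>i\<le>n. finite_poset (Qs i)"
      "\<forall>i\<le>m. minimal_surjective_P_morphism (Qs i) (Qs (Suc i)) (fs (Suc i))"
      "f = composite fs n"
    unfolding n by blast
  have "minimal_surjective_P_morphism (Qs (i - 1)) (Qs i) (fs i)" if "i \<in> {1..n}" for i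
    using Qs(4) that n by (cases i) auto
  with Qs show "\<exists>(Qs :: nat \<Rightarrow> 'a rel) (fs :: nat \<Rightarrow> 'a \<rightharpoonup> 'a).
              Qs 0 = P \<and> Qs n = Q \<and>
              (\<forall>i\<le>n. finite_poset (Qs i)) \<and>
              (\<forall>i\<in>{1..n}. minimal_surjective_P_morphism (Qs (i - 1)) (Qs i) (fs i)) \<and>
              f = composite fs n"
    by blast
qed

end
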